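(* Let $\ell\ge1$, $d\ge2$, and let $\mathbb E^{\ell d-1}=\{\boldsymbol x\in\mathbb R^{\ell d}:\langle\boldsymbol x,B\boldsymbol x\rangle=c\}$, where $c>0$ and $B\in\mathbb R^{\ell d\times\ell d}$ is a symmetric positive definite $\ell$-block matrix. Let $A\in\mathbb R^{\ell d\times\ell d}$ be a symmetric non-zero $\ell$-block matrix which is not a scalar multiple of $B$ (i.e. $A\ne\alpha B$ for every $\alpha\in\mathbb R$). For $0<\beta<1$ and $\rho>\beta$ define $$\mathbb A^{\ell d}_{\beta,\rho}=\{\boldsymbol x\in\mathbb R^{\ell d}:\rho-\beta\le\langle\boldsymbol x,A\boldsymbol x\rangle\le\rho+\beta\}.$$ Then $$\int_{\mathbb E^{\ell d-1}}\mathbf 1_{\mathbb A^{\ell d}_{\beta,\rho}}(\boldsymbol x)\,d\boldsymbol x\lesssim\beta,$$ where $d\boldsymbol x$ is the surface measure on $\mathbb E^{\ell d-1}$ and the implicit constant is independent of $\beta$ (it may depend on $d,\ell,A,B,c,\rho$).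
   Context: An $\ell$-block matrix is a matrix in $\mathbb R^{\ell d\times\ell d}$ of the form $(a_{i,j}I_d)_{1\le i,j\le\ell}$ with $a_{i,j}\in\mathbb R$ and $I_d$ the $d\times d$ identity matrix. *)

theory Defs
  imports "HOL-Analysis.Analysis"
begin

section \<open>Hausdorff measure and surface measure\<close>

text \<open>
  The cost is the volume of the \<open>s\<close>-dimensional ball with the diameter of \<open>U\<close>. With this
  normalisation the \<open>s\<close>-dimensional Hausdorff measure restricted to a smooth \<open>s\<close>-dimensional
  submanifold of a Euclidean space is the usual surface measure. The empty set is
  treated separately because of \<open>0 ^ 0 = 1\<close>.
\<close>
definition hausdorff_cost :: "nat \<Rightarrow> 'a::metric_space set \<Rightarrow> ennreal" where
  "hausdorff_cost s U =
     (if U = {} then 0 else ennreal (unit_ball_vol (real s) * (diameter U / 2) ^ s))"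

text \<open>
  Boundedness has to be required explicitly, since \<^const>\<open>diameter\<close> is unspecified on
  unbounded sets.
\<close>
definition hausdorff_pre :: "nat \<Rightarrow> real \<Rightarrow> 'a::metric_space set \<Rightarrow> ennreal" where
  "hausdorff_pre s \<delta> S =
     (INF U\<in>{U :: nat \<Rightarrow> 'a set. S \<subseteq> (\<Union>i. U i) \<and> (\<forall>i. bounded (U i) \<and> diameter (U i) \<le> \<delta>)}.
        \<Sum>i. hausdorff_cost s (U i))"

definition hausdorff_outer :: "nat \<Rightarrow> 'a::metric_space set \<Rightarrow> ennreal" where
  "hausdorff_outer s S = (SUP \<delta>\<in>{0<..}. hausdorff_pre s \<delta> S)"

text \<open>
  That this really is a measure with the given values on all Borel sets is shown in
  \<open>emeasure_hausdorff_measure\<close> below.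
\<close>
definition hausdorff_measure :: "nat \<Rightarrow> 'a::metric_space measure" where
  "hausdorff_measure s = measure_of UNIV (sets borel) (hausdorff_outer s)"

definition surface_measure :: "'a::euclidean_space set \<Rightarrow> 'a measure" where
  "surface_measure E = restrict_space (hausdorff_measure (DIM('a) - 1)) E"

subsection \<open>The Hausdorff outer measure is a measure on the Borel sets\<close>

lemma hausdorff_cost_empty [simp]: "hausdorff_cost s {} = 0"
  by (simp add: hausdorff_cost_def)

lemma hausdorff_pre_le:
  assumes "S \<subseteq> (\<Union>i. U i)" "\<And>i. bounded (U i)" "\<And>i. diameter (U i) \<le> \<delta>"
  shows "hausdorff_pre s \<delta> S \<le> (\<Sum>i. hausdorff_cost s (U i))"
  unfolding hausdorff_pre_def by (rule INF_lower) (use assms in auto)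

lemma hausdorff_pre_mono: "S \<subseteq> T \<Longrightarrow> hausdorff_pre s \<delta> S \<le> hausdorff_pre s \<delta> T"
  unfolding hausdorff_pre_def by (rule INF_superset_mono) auto

lemma hausdorff_pre_antimono: "\<delta> \<le> \<epsilon> \<Longrightarrow> hausdorff_pre s \<epsilon> S \<le> hausdorff_pre s \<delta> S"
  unfolding hausdorff_pre_def by (rule INF_superset_mono) (auto intro: order_trans)

lemma hausdorff_pre_empty: "0 < \<delta> \<Longrightarrow> hausdorff_pre s \<delta> {} = 0"
  using hausdorff_pre_le[of "{}" "\<lambda>_. {}" \<delta> s] by simp

lemma hausdorff_pre_countably_subadditive:
  "hausdorff_pre s \<delta> (\<Union>n. A n) \<le> (\<Sum>n::nat. hausdorff_pre s \<delta> (A n))"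
proof (rule ennreal_le_epsilon)
  fix e :: real assume e: "0 < e" and fin: "(\<Sum>n. hausdorff_pre s \<delta> (A n)) < top"
  have "\<exists>U. A n \<subseteq> (\<Union>i. U i) \<and> (\<forall>i. bounded (U i) \<and> diameter (U i) \<le> \<delta>) \<and>
      (\<Sum>i. hausdorff_cost s (U i)) < hausdorff_pre s \<delta> (A n) + e * (1/2)^Suc n" for n
  proof -
    have "hausdorff_pre s \<delta> (A n) < hausdorff_pre s \<delta> (A n) + e * (1/2)^Suc n"
      using e fin by (auto simp add: less_top dest!: ennreal_suminf_lessD)
    then show ?thesis
      by (subst (asm) hausdorff_pre_def) (auto simp: INF_less_iff)
  qed
  then obtain U where U: "\<And>n. A n \<subseteq> (\<Union>i. U n i)" "\<And>n i. bounded (U n i)"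
      "\<And>n i. diameter (U n i) \<le> \<delta>"
      "\<And>n. (\<Sum>i. hausdorff_cost s (U n i)) < hausdorff_pre s \<delta> (A n) + e * (1/2)^Suc n"
    by metis
  define C where "C = case_prod U o prod_decode"
  have "(\<Union>n. A n) \<subseteq> (\<Union>i. C i)"
    using U(1) by (auto simp add: C_def subset_eq) (metis prod.case prod_encode_inverse)
  then have "hausdorff_pre s \<delta> (\<Union>n. A n) \<le> (\<Sum>i. hausdorff_cost s (C i))"
    by (rule hausdorff_pre_le) (auto simp: C_def U split: prod.split)
  also have "\<dots> = (\<Sum>n. \<Sum>i. hausdorff_cost s (U n i))"
    using suminf_ennreal_2dimen[of "\<lambda>n. \<Sum>i. hausdorff_cost s (U n i)"
        "\<lambda>p. hausdorff_cost s (U (fst p) (snd p))"]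
    by (simp add: C_def case_prod_beta)
  also have "\<dots> \<le> (\<Sum>n. hausdorff_pre s \<delta> (A n) + e * (1/2) ^ Suc n)"
    by (intro suminf_le less_imp_le U) auto
  also have "\<dots> = (\<Sum>n. hausdorff_pre s \<delta> (A n)) + (\<Sum>n. ennreal e * ennreal ((1/2) ^ Suc n))"
    using e by (subst suminf_add[symmetric])
               (auto simp del: ennreal_suminf_cmult simp add: ennreal_mult[symmetric])
  also have "\<dots> = (\<Sum>n. hausdorff_pre s \<delta> (A n)) + e"
    unfolding ennreal_suminf_cmult
    by (subst suminf_ennreal_eq[OF zero_le_power power_half_series]) auto
  finally show "hausdorff_pre s \<delta> (\<Union>n. A n) \<le> (\<Sum>n. hausdorff_pre s \<delta> (A n)) + e" .
qed

lemma hausdorff_pre_le_outer: "0 < \<delta> \<Longrightarrow> hausdorff_pre s \<delta> S \<le> hausdorff_outer s S"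
  unfolding hausdorff_outer_def by (rule SUP_upper) auto

lemma hausdorff_outer_mono: "S \<subseteq> T \<Longrightarrow> hausdorff_outer s S \<le> hausdorff_outer s T"
  unfolding hausdorff_outer_def by (intro SUP_mono') (rule hausdorff_pre_mono)

lemma hausdorff_outer_empty [simp]: "hausdorff_outer s {} = 0"
  unfolding hausdorff_outer_def by (auto simp: hausdorff_pre_empty intro!: antisym SUP_least)

lemma hausdorff_outer_countably_subadditive:
  "hausdorff_outer s (\<Union>n. A n) \<le> (\<Sum>n::nat. hausdorff_outer s (A n))"
  unfolding hausdorff_outer_def[of s "\<Union>n. A n"]
proof (rule SUP_least)
  fix \<delta> :: real assume "\<delta> \<in> {0<..}"
  then show "hausdorff_pre s \<delta> (\<Union>n. A n) \<le> (\<Sum>n. hausdorff_outer s (A n))"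
    by (intro order_trans[OF hausdorff_pre_countably_subadditive] suminf_le
        hausdorff_pre_le_outer) auto
qed

lemma outer_measure_space_hausdorff:
  "outer_measure_space (Pow UNIV) (hausdorff_outer s)"
  by (auto simp: outer_measure_space_def positive_def increasing_def countably_subadditive_def
      intro: hausdorff_outer_mono hausdorff_outer_countably_subadditive)

lemma hausdorff_outer_Un_le: "hausdorff_outer s (A \<union> B) \<le> hausdorff_outer s A + hausdorff_outer s B"
proof -
  have "subadditive (Pow UNIV) (hausdorff_outer s)"
    using outer_measure_space_hausdorff[of s] algebra_Pow[of UNIV]
    unfolding outer_measure_space_def
    by (meson algebra.axioms(1) ring_of_sets.countably_subadditive_subadditive)
  from subadditiveD[OF this, of "A" "B - A"] have
    "hausdorff_outer s (A \<union> B) \<le> hausdorff_outer s A + hausdorff_outer s (B - A)" by auto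
  also have "\<dots> \<le> hausdorff_outer s A + hausdorff_outer s B"
    by (intro add_left_mono hausdorff_outer_mono) auto
  finally show ?thesis .
qed

lemma hausdorff_outer_separated:
  assumes e: "0 < e" and sep: "\<And>x y. x \<in> A \<Longrightarrow> y \<in> B \<Longrightarrow> e \<le> dist x y"
  shows "hausdorff_outer s A + hausdorff_outer s B \<le> hausdorff_outer s (A \<union> B)"
proof -
  have pre: "hausdorff_pre s \<delta> A + hausdorff_pre s \<delta> B \<le> hausdorff_pre s \<delta> (A \<union> B)"
    if \<delta>: "0 < \<delta>" "\<delta> < e" for \<delta>
    unfolding hausdorff_pre_def[of s \<delta> "A \<union> B"]
  proof (rule INF_greatest)
    fix U :: "nat \<Rightarrow> 'a set"
    assume "U \<in> {U. A \<union> B \<subseteq> (\<Union>i. U i) \<and> (\<forall>i. bounded (U i) \<and> diameter (U i) \<le> \<delta>)}"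
    then have U: "A \<union> B \<subseteq> (\<Union>i. U i)" "\<And>i. bounded (U i)" "\<And>i. diameter (U i) \<le> \<delta>" by auto
    define V where "V i = (if U i \<inter> A = {} then {} else U i)" for i
    define W where "W i = (if U i \<inter> B = {} then {} else U i)" for i
    have "A \<subseteq> (\<Union>i. V i)" "B \<subseteq> (\<Union>i. W i)"
      using U(1) unfolding V_def W_def by (fastforce simp: subset_eq)+
    then have "hausdorff_pre s \<delta> A + hausdorff_pre s \<delta> B
        \<le> (\<Sum>i. hausdorff_cost s (V i)) + (\<Sum>i. hausdorff_cost s (W i))"
      using U \<delta> by (intro add_mono hausdorff_pre_le) (auto simp: V_def W_def)
    also have "\<dots> = (\<Sum>i. hausdorff_cost s (V i) + hausdorff_cost s (W i))"
      by (rule suminf_add) auto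
    also have "\<dots> \<le> (\<Sum>i. hausdorff_cost s (U i))"
    proof (intro suminf_le)
      fix i
      have "\<not> (x \<in> U i \<and> x \<in> A \<and> y \<in> U i \<and> y \<in> B)" for x y
        using diameter_bounded_bound[OF U(2)[of i], of x y] U(3)[of i] \<delta> sep[of x y] by force
      then have "U i \<inter> A = {} \<or> U i \<inter> B = {}" by blast
      then show "hausdorff_cost s (V i) + hausdorff_cost s (W i) \<le> hausdorff_cost s (U i)"
        by (auto simp: V_def W_def)
    qed auto
    finally show "hausdorff_pre s \<delta> A + hausdorff_pre s \<delta> B \<le> (\<Sum>i. hausdorff_cost s (U i))" .
  qed
  have bound: "hausdorff_pre s \<delta> A + hausdorff_pre s \<epsilon> B \<le> hausdorff_outer s (A \<union> B)"
    if "0 < \<delta>" "0 < \<epsilon>" for \<delta> \<epsilon>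
  proof -
    define \<eta> where "\<eta> = min (min \<delta> \<epsilon>) (e/2)"
    have \<eta>: "0 < \<eta>" "\<eta> < e" "\<eta> \<le> \<delta>" "\<eta> \<le> \<epsilon>" using that e by (auto simp: \<eta>_def)
    have "hausdorff_pre s \<delta> A + hausdorff_pre s \<epsilon> B \<le> hausdorff_pre s \<eta> A + hausdorff_pre s \<eta> B"
      by (intro add_mono hausdorff_pre_antimono \<eta>)
    also have "\<dots> \<le> hausdorff_outer s (A \<union> B)"
      using pre[OF \<eta>(1,2)] hausdorff_pre_le_outer[OF \<eta>(1)] order_trans by blast
    finally show ?thesis .
  qed
  have ne: "{0<..} \<noteq> ({}::real set)" by (auto intro: exI[of _ 1])
  have "hausdorff_outer s A + hausdorff_outer s B
      = (SUP \<delta>\<in>{0<..}. SUP \<epsilon>\<in>{0<..}. hausdorff_pre s \<delta> A + hausdorff_pre s \<epsilon> B)"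
    unfolding hausdorff_outer_def
    by (subst ennreal_SUP_add_left[OF ne, symmetric])
       (auto intro!: SUP_cong simp: ennreal_SUP_add_right[OF ne])
  also have "\<dots> \<le> hausdorff_outer s (A \<union> B)"
    by (intro SUP_least bound) auto
  finally show ?thesis .
qed

lemma hausdorff_outer_closed_split:
  fixes F X :: "'a::metric_space set"
  assumes F: "closed F"
  shows "hausdorff_outer s (X \<inter> F) + hausdorff_outer s (X - F) \<le> hausdorff_outer s X"
proof (cases "F = {} \<or> hausdorff_outer s X = top")
  case True
  then show ?thesis by auto
next
  case False
  then have ne: "F \<noteq> {}" and fin: "hausdorff_outer s X < top" by (auto simp: less_top)
  let ?H = "hausdorff_outer s"
  define r where "r n = 1 / (real n + 1)" for n
  define N where "N n = {x\<in>X. r n \<le> infdist x F}" for n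
  define D where "D n = N (Suc n) - N n" for n
  have r_pos: "0 < r n" for n by (simp add: r_def)
  have r_less: "r n < r m" if "m < n" for m n using that by (simp add: r_def frac_less2)
  have r_le: "r n \<le> r m" if "m \<le> n" for m n using that by (simp add: r_def frac_le)
  have N_mono: "N m \<subseteq> N n" if "m \<le> n" for m n
    using r_le[OF that] by (auto simp: N_def)
  have D_bounds: "x \<in> X \<and> r (Suc n) \<le> infdist x F \<and> infdist x F < r n" if "x \<in> D n" for x n
    using that by (auto simp: D_def N_def)
  have XF: "X - F = (\<Union>n. N n)"
  proof safe
    fix x assume x: "x \<in> X" "x \<notin> F"
    then have "0 < infdist x F"
      using in_closed_iff_infdist_zero[OF F ne, of x] infdist_nonneg[of x F] by linarith
    from reals_Archimedean[OF this] obtain n where "inverse (real (Suc n)) < infdist x F" ..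
    then have "x \<in> N n" using x by (simp add: N_def r_def inverse_eq_divide add.commute)
    then show "x \<in> (\<Union>n. N n)" by blast
  next
    fix x n assume "x \<in> N n" then show "x \<in> X" by (simp add: N_def)
  next
    fix x n assume "x \<in> N n" "x \<in> F"
    then show False using r_pos[of n] by (simp add: N_def)
  qed
  have tail: "X - F \<subseteq> N n \<union> (\<Union>k. D (k + n))" for n
  proof
    fix x assume "x \<in> X - F"
    then have ex: "\<exists>m. x \<in> N m" by (auto simp: XF)
    define m where "m = (LEAST m. x \<in> N m)"
    have m: "x \<in> N m" unfolding m_def by (rule LeastI_ex[OF ex])
    show "x \<in> N n \<union> (\<Union>k. D (k + n))"
    proof (cases "m \<le> n")
      case True then show ?thesis using m N_mono by blast
    next
      case False
      then obtain k where k: "m = Suc (k + n)"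
        by (metis add.commute less_iff_Suc_add not_le)
      have "x \<notin> N (k + n)" using not_less_Least[of "k + n" "\<lambda>m. x \<in> N m"] k by (simp add: m_def)
      then show ?thesis using m k by (auto simp: D_def)
    qed
  qed
  have dist_ge: "infdist x F - infdist y F \<le> dist x y" for x y
    using infdist_triangle[of x F y] by simp
  have near: "?H (X \<inter> F) + ?H (N n) \<le> ?H X" for n
  proof -
    have "?H (N n) + ?H (X \<inter> F) \<le> ?H (N n \<union> (X \<inter> F))"
    proof (rule hausdorff_outer_separated[OF r_pos[of n]])
      fix x y assume "x \<in> N n" "y \<in> X \<inter> F"
      then show "r n \<le> dist x y" using dist_ge[of x y] by (simp add: N_def)
    qed
    also have "\<dots> \<le> ?H X" by (intro hausdorff_outer_mono) (auto simp: N_def)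
    finally show ?thesis by (simp add: add.commute)
  qed
  have part: "(\<Sum>k<n. ?H (D (2*k+j))) \<le> ?H (\<Union>k<n. D (2*k+j))" for n j
  proof (induction n)
    case 0 show ?case by simp
  next
    case (Suc n)
    have "(\<Sum>k<Suc n. ?H (D (2*k+j))) \<le> ?H (\<Union>k<n. D (2*k+j)) + ?H (D (2*n+j))"
      using Suc by (simp add: add_right_mono)
    also have "\<dots> \<le> ?H ((\<Union>k<n. D (2*k+j)) \<union> D (2*n+j))"
    proof (cases "n = 0")
      case True then show ?thesis by simp
    next
      case False
      show ?thesis
      proof (rule hausdorff_outer_separated)
        show "0 < r (2*n+j - 1) - r (2*n+j)" using r_less[of "2*n+j-1" "2*n+j"] False by simp
        fix x y assume "x \<in> (\<Union>k<n. D (2*k+j))" and y: "y \<in> D (2*n+j)"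
        then obtain k where k: "k < n" "x \<in> D (2*k+j)" by auto
        have "r (2*n+j-1) \<le> r (Suc (2*k+j))" using k by (intro r_le) auto
        then show "r (2*n+j - 1) - r (2*n+j) \<le> dist x y"
          using D_bounds[OF k(2)] D_bounds[OF y] dist_ge[of x y] by linarith
      qed
    qed
    also have "(\<Union>k<n. D (2*k+j)) \<union> D (2*n+j) = (\<Union>k<Suc n. D (2*k+j))"
      by (auto simp: lessThan_Suc)
    finally show ?case .
  qed
  have part': "(\<Sum>k<n. ?H (D (2*k+j))) \<le> ?H X" for n j
    using part[of j n] by (rule order_trans) (auto intro!: hausdorff_outer_mono dest: D_bounds)
  have sum_le: "(\<Sum>k. ?H (D k)) \<le> ?H X + ?H X"
  proof (rule suminf_le_const[OF summableI])
    fix n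
    have "(\<Sum>k<n. ?H (D k)) \<le> (\<Sum>k<2*n. ?H (D k))" by (rule sum_mono2) auto
    also have "\<dots> = (\<Sum>k<n. ?H (D (2*k+0))) + (\<Sum>k<n. ?H (D (2*k+1)))"
      by (induction n) (auto simp: algebra_simps)
    also have "\<dots> \<le> ?H X + ?H X" by (intro add_mono part')
    finally show "(\<Sum>k<n. ?H (D k)) \<le> ?H X + ?H X" .
  qed
  have fin_sum: "(\<Sum>k. ?H (D k)) < top"
    using sum_le fin by (metis ennreal_add_less_top le_less_trans)
  show ?thesis
  proof (rule ennreal_le_epsilon)
    fix e :: real assume e: "0 < e"
    have "(\<lambda>n. \<Sum>k<n. ?H (D k)) \<longlonglongrightarrow> (\<Sum>k. ?H (D k))"
      by (rule summable_LIMSEQ[OF summableI])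
    then have "(\<lambda>n. (\<Sum>k. ?H (D k)) - (\<Sum>k<n. ?H (D k))) \<longlonglongrightarrow> (\<Sum>k. ?H (D k)) - (\<Sum>k. ?H (D k))"
      using fin_sum by (intro tendsto_diff_ennreal tendsto_const) auto
    then have "\<forall>\<^sub>F n in sequentially. (\<Sum>k. ?H (D k)) - (\<Sum>k<n. ?H (D k)) < ennreal e"
      using e fin_sum by (auto dest!: order_tendstoD(2)[where a="ennreal e"] simp: less_top)
    then obtain n where n: "(\<Sum>k. ?H (D k)) - (\<Sum>k<n. ?H (D k)) < ennreal e"
      by (auto simp: eventually_sequentially)
    have split: "(\<Sum>k. ?H (D k)) = (\<Sum>k. ?H (D (k+n))) + (\<Sum>k<n. ?H (D k))"
      by (rule suminf_offset[OF summableI])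
    have "(\<Sum>k<n. ?H (D k)) < top" using fin_sum split by (metis ennreal_add_eq_top less_top)
    then have t: "(\<Sum>k. ?H (D (k+n))) < ennreal e"
      using n split by (simp add: less_top)
    have "?H (X - F) \<le> ?H (N n) + ?H (\<Union>k. D (k + n))"
      using hausdorff_outer_mono[OF tail[of n]] hausdorff_outer_Un_le order_trans by blast
    also have "\<dots> \<le> ?H (N n) + e"
      using hausdorff_outer_countably_subadditive[of s "\<lambda>k. D (k+n)"] t
      by (intro add_left_mono) (meson le_less_trans less_imp_le)
    finally have "?H (X \<inter> F) + ?H (X - F) \<le> ?H (X \<inter> F) + (?H (N n) + e)"
      by (rule add_left_mono)
    also have "\<dots> \<le> ?H X + e"
      using near[of n] by (simp add: add.assoc[symmetric] add_right_mono)
    finally show "?H (X \<inter> F) + ?H (X - F) \<le> ?H X + e" .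
  qed
qed

lemma measure_space_hausdorff:
  "measure_space (UNIV :: 'a::metric_space set) (sets borel) (hausdorff_outer s)"
proof -
  interpret P: sigma_algebra "UNIV :: 'a set" "Pow UNIV" by (rule sigma_algebra_Pow)
  let ?L = "lambda_system (UNIV :: 'a set) (Pow UNIV) (hausdorff_outer s)"
  have L: "measure_space (UNIV :: 'a set) ?L (hausdorff_outer s)"
    by (rule P.caratheodory_lemma[OF outer_measure_space_hausdorff])
  then interpret L: sigma_algebra "UNIV :: 'a set" ?L by (simp add: measure_space_def)
  have closed_L: "F \<in> ?L" if "closed F" for F
    unfolding P.lambda_system_eq
  proof (safe; (rule antisym)?)
    fix X
    show "hausdorff_outer s (X \<inter> F) + hausdorff_outer s (X - F) \<le> hausdorff_outer s X"
      by (rule hausdorff_outer_closed_split[OF that])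
    show "hausdorff_outer s X \<le> hausdorff_outer s (X \<inter> F) + hausdorff_outer s (X - F)"
      using hausdorff_outer_Un_le[of s "X \<inter> F" "X - F"] by (simp add: Int_Diff_Un)
  qed auto
  have "sets borel \<subseteq> ?L"
    unfolding borel_eq_closed
    by (subst sets_measure_of) (use L.sigma_sets_subset[of "Collect closed"] closed_L in blast)+
  with L show ?thesis
    using sets.sigma_algebra_axioms[of "borel :: 'a measure"]
    by (auto simp: measure_space_def positive_def countably_additive_def)
qed

lemma sets_hausdorff_measure [simp, measurable_cong]: "sets (hausdorff_measure s) = sets borel"
  using sets.sigma_sets_eq[of "borel :: 'a measure"]
  by (simp add: hausdorff_measure_def sets_measure_of_conv)

lemma space_hausdorff_measure [simp]: "space (hausdorff_measure s) = UNIV"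
  by (simp add: hausdorff_measure_def space_measure_of_conv)

lemma emeasure_hausdorff_measure:
  fixes S :: "'a::metric_space set"
  assumes "S \<in> sets borel"
  shows "emeasure (hausdorff_measure s) S = hausdorff_outer s S"
  using measure_space_hausdorff[of s, where 'a='a] assms
  unfolding hausdorff_measure_def measure_space_def
  by (intro emeasure_measure_of_sigma) auto

section \<open>Block matrices, ellipsoids and quadratic annuli\<close>

text \<open>
  \<open>\<real>\<^bsup>\<ell>d\<^esup>\<close> is rendered as \<open>real ^ ('l \<times> 'd)\<close> with \<open>\<ell> = CARD('l)\<close> and \<open>d = CARD('d)\<close>: the index
  \<open>(i, k)\<close> is the \<open>k\<close>-th coordinate of the \<open>i\<close>-th block. The block in position \<open>(i, j)\<close> is
  \<open>a i j\<close> times the \<open>d \<times> d\<close> identity matrix.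
\<close>
definition is_block_matrix :: "real ^ ('l::finite \<times> 'd::finite) ^ ('l \<times> 'd) \<Rightarrow> bool" where
  "is_block_matrix M \<longleftrightarrow>
     (\<exists>a :: 'l \<Rightarrow> 'l \<Rightarrow> real. \<forall>i j k m.
        M $ (i, k) $ (j, m) = a i j * (mat 1 :: real ^ 'd ^ 'd) $ k $ m)"

definition symmetric_matrix :: "real ^ 'n ^ 'n \<Rightarrow> bool" where
  "symmetric_matrix M \<longleftrightarrow> transpose M = M"

definition positive_definite :: "real ^ 'n ^ 'n \<Rightarrow> bool" where
  "positive_definite M \<longleftrightarrow> (\<forall>x. x \<noteq> 0 \<longrightarrow> 0 < x \<bullet> (M *v x))"

definition ellipsoid :: "real ^ 'n ^ 'n \<Rightarrow> real \<Rightarrow> (real ^ 'n) set" where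
  "ellipsoid B c = {x. x \<bullet> (B *v x) = c}"

definition quadratic_annulus :: "real ^ 'n ^ 'n \<Rightarrow> real \<Rightarrow> real \<Rightarrow> (real ^ 'n) set" where
  "quadratic_annulus A \<beta> \<rho> = {x. \<rho> - \<beta> \<le> x \<bullet> (A *v x) \<and> x \<bullet> (A *v x) \<le> \<rho> + \<beta>}"

end

theory Submission
  imports Defs
begin

text \<open>
  Let \<open>N\<close> be the intersection of the ellipsoid and the annulus. Comparing a maximal \<open>r\<close>-separated
  subset of \<open>N\<close> with the volume of the \<open>r/2\<close>-neighbourhood of \<open>N\<close> reduces the claim to a Lebesgue
  measure estimate: for \<open>e = O(r)\<close> and \<open>h = O(\<beta>)\<close>, the part in a ball of
  \<open>{y. \<bar>\<langle>y, By\<rangle> - c\<bar> \<le> e \<and> \<bar>\<langle>y, Ay\<rangle> - \<rho>\<bar> \<le> h}\<close> has volume \<open>O(e h)\<close>.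

  Since \<open>A\<close> is not a multiple of \<open>B\<close>, the maximum \<open>\<lambda>\<close> and the minimum \<open>\<mu>\<close> of
  \<open>\<langle>x, Ax\<rangle> / \<langle>x, Bx\<rangle>\<close> differ; they are generalized eigenvalues, and by the block structure and
  \<open>d \<ge> 2\<close> each has two \<open>B\<close>-orthonormal eigenvectors. Along the affine 4-spaces spanned by these
  vectors, after completing squares, both forms depend only on the squared radii \<open>|u|\<^sup>2\<close>, \<open>|v|\<^sup>2\<close> in
  two planes, through the linearly independent combinations \<open>|u|\<^sup>2 + |v|\<^sup>2\<close> and
  \<open>\<lambda>|u|\<^sup>2 + \<mu>|v|\<^sup>2\<close>. Planar Lebesgue measure pushed forward by the squared radius has constant density,
  so each slice has measure \<open>O(e h)\<close>. Averaging over translations in the four directions passes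
  from the slices to the volume without choosing a complementary subspace.
\<close>

section \<open>Hausdorff measure and the volume of neighbourhoods\<close>

text \<open>Packing against covering: the balls of radius \<open>r / 2\<close> around an
  \<open>r\<close>-separated subset of \<open>S\<close> are disjoint and lie in \<open>T\<close>,
  which bounds the number of points by a multiple of \<open>M / r ^ n\<close>. If the subset is
  maximal, the balls of radius \<open>r\<close> cover \<open>S\<close>; their diameter
  \<open>2 * r\<close> is the scale, and each costs a multiple of
  \<open>r ^ (n - 1)\<close>.\<close>

lemma hausdorff_pre_le_volume:
  fixes S T :: "'a::euclidean_space set"
  assumes r: "0 < r" and T: "T \<in> sets lborel" "emeasure lborel T \<le> ennreal M" "0 \<le> M"
    and S: "\<And>x. x \<in> S \<Longrightarrow> ball x (r / 2) \<subseteq> T"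
  shows "hausdorff_pre (DIM('a) - 1) (2 * r) S
    \<le> ennreal (unit_ball_vol (real (DIM('a) - 1)) / unit_ball_vol (real DIM('a)) * 2 ^ DIM('a) * M / r)"
proof -
  let ?n = "DIM('a)"
  define v where "v = unit_ball_vol (real ?n) * (r / 2) ^ ?n"
  have v: "0 < v" using r by (simp add: v_def)
  define sep where "sep F \<longleftrightarrow> finite F \<and> F \<subseteq> S \<and> pairwise (\<lambda>x y. r \<le> dist x y) F" for F
  have card_le: "real (card F) * v \<le> M" if "sep F" for F
  proof -
    have "disjoint_family_on (\<lambda>x. ball x (r / 2)) F"
    proof (unfold disjoint_family_on_def, intro ballI impI)
      fix x y assume "x \<in> F" "y \<in> F" "x \<noteq> y"
      then have "r \<le> dist x y" using that by (auto simp: sep_def pairwise_def)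
      then show "ball x (r / 2) \<inter> ball y (r / 2) = {}"
        by (intro disjoint_ballI) simp
    qed
    then have "(\<Sum>x\<in>F. emeasure lborel (ball x (r / 2))) = emeasure lborel (\<Union>x\<in>F. ball x (r / 2))"
      using that by (intro sum_emeasure) (auto simp: sep_def)
    also have "\<dots> \<le> emeasure lborel T"
      using that S T by (intro emeasure_mono) (auto simp: sep_def)
    finally have "of_nat (card F) * ennreal v \<le> ennreal M"
      using r T(2) by (simp add: emeasure_ball v_def)
    then show ?thesis
      using T(3) v by (simp add: ennreal_of_nat_eq_real_of_nat ennreal_mult'[symmetric])
  qed
  \<comment> \<open>The volume bound caps the cardinalities, so a separated set with the most points
    exists.\<close>
  have "\<exists>F. sep F \<and> (\<forall>G. sep G \<longrightarrow> card G \<le> card F)"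
  proof (rule ex_has_greatest_nat)
    show "sep {}" by (simp add: sep_def)
    show "\<forall>G. sep G \<longrightarrow> card G < Suc (nat \<lceil>M / v\<rceil>)"
    proof (intro allI impI)
      fix G assume "sep G"
      then have "real (card G) \<le> M / v" using card_le v by (simp add: pos_le_divide_eq)
      then show "card G < Suc (nat \<lceil>M / v\<rceil>)" by linarith
    qed
  qed
  then obtain F where F: "sep F" "\<And>G. sep G \<Longrightarrow> card G \<le> card F" by blast
  have fin: "finite F" using F(1) by (simp add: sep_def)
  have cover: "\<exists>y\<in>F. dist x y \<le> r" if x: "x \<in> S" for x
  proof (rule ccontr)
    assume "\<not> (\<exists>y\<in>F. dist x y \<le> r)"
    then have far: "\<And>y. y \<in> F \<Longrightarrow> r < dist x y" by force
    then have "x \<notin> F" using r by force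
    moreover have "sep (insert x F)"
      using F(1) x far by (auto simp: sep_def pairwise_insert dist_commute intro: less_imp_le)
    ultimately show False using F(2)[of "insert x F"] fin by simp
  qed
  obtain f where f: "bij_betw f {0..<card F} F"
    using ex_bij_betw_nat_finite[OF fin] by blast
  \<comment> \<open>The finite cover is padded with empty sets, which cost nothing, to form a
    sequence.\<close>
  define U where "U i = (if i < card F then cball (f i) r else {})" for i
  have "S \<subseteq> (\<Union>i. U i)"
  proof
    fix x assume "x \<in> S"
    then obtain y where y: "y \<in> F" "dist x y \<le> r" using cover by blast
    then obtain i where "i < card F" "y = f i" using f unfolding bij_betw_def by force
    then show "x \<in> (\<Union>i. U i)" using y by (auto simp: U_def dist_commute intro!: exI[of _ i])
  qed
  then have "hausdorff_pre (?n - 1) (2 * r) S \<le> (\<Sum>i. hausdorff_cost (?n - 1) (U i))"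
    using r by (intro hausdorff_pre_le) (auto simp: U_def diameter_cball)
  also have "\<dots> = (\<Sum>i<card F. hausdorff_cost (?n - 1) (U i))"
    by (rule suminf_finite) (auto simp: U_def)
  also have "\<dots> = (\<Sum>i<card F. ennreal (unit_ball_vol (real (?n - 1)) * r ^ (?n - 1)))"
    using r by (intro sum.cong) (auto simp: U_def hausdorff_cost_def diameter_cball)
  also have "\<dots> = ennreal (real (card F) * (unit_ball_vol (real (?n - 1)) * r ^ (?n - 1)))"
    using r by (simp add: ennreal_of_nat_eq_real_of_nat ennreal_mult'[symmetric])
  also have "\<dots> \<le> ennreal (M / v * (unit_ball_vol (real (?n - 1)) * r ^ (?n - 1)))"
    using card_le[OF F(1)] v r by (intro ennreal_leI mult_right_mono) (auto simp: field_simps)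
  also have "M / v * (unit_ball_vol (real (?n - 1)) * r ^ (?n - 1))
      = unit_ball_vol (real (?n - 1)) / unit_ball_vol (real ?n) * 2 ^ ?n * M / r"
  proof -
    have "r ^ ?n = r * r ^ (?n - 1)"
      by (metis DIM_positive power_minus_mult mult.commute)
    then show ?thesis using r by (simp add: v_def power_divide)
  qed
  finally show ?thesis .
qed

text \<open>Smaller scales give larger values of \<open>hausdorff_pre\<close>, so scales up to
  \<open>d\<close> determine the supremum.\<close>

lemma hausdorff_outer_le_if_small_pre:
  assumes d: "0 < d" and le: "\<And>r. 0 < r \<Longrightarrow> r \<le> d \<Longrightarrow> hausdorff_pre s r S \<le> K"
  shows "hausdorff_outer s S \<le> K"
  unfolding hausdorff_outer_def
proof (rule SUP_least)
  fix e :: real assume "e \<in> {0<..}"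
  then have "hausdorff_pre s (min d e) S \<le> K" using d by (intro le) auto
  then show "hausdorff_pre s e S \<le> K"
    using hausdorff_pre_antimono[of "min d e" e s S] by simp
qed

section \<open>Generalized eigenvectors of pairs of quadratic forms\<close>

text \<open>A zero of a nonnegative form is a minimum. Moving from \<open>p\<close> along
  \<open>h = g p\<close> changes the form by \<open>2 * t * N + t\<^sup>2 * k\<close>, which is
  negative for small negative \<open>t\<close> unless \<open>N = 0\<close>.\<close>

lemma psd_form_zero_imp_zero:
  fixes g :: "'a::real_inner \<Rightarrow> 'a"
  assumes g: "linear g" "\<And>x y. x \<bullet> g y = y \<bullet> g x" and psd: "\<And>x. 0 \<le> x \<bullet> g x" and p: "p \<bullet> g p = 0"
  shows "g p = 0"
proof -
  define h where "h = g p"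
  define N k where "N = h \<bullet> h" and "k = h \<bullet> g h"
  have k: "0 \<le> k" using psd by (simp add: k_def)
  \<comment> \<open>The exact minimiser is \<open>- N / k\<close>; the \<open>+ 1\<close> covers the
    case \<open>k = 0\<close>.\<close>
  define t where "t = - N / (k + 1)"
  have "0 \<le> (p + t *\<^sub>R h) \<bullet> g (p + t *\<^sub>R h)" by (rule psd)
  also have "\<dots> = 2 * t * N + t\<^sup>2 * k"
    using p g(2)[of p h]
    by (simp add: linear_add[OF g(1)] linear_scale[OF g(1)] inner_simps N_def k_def power2_eq_square
        h_def[symmetric] distrib_left)
  also have "\<dots> = - (N\<^sup>2 * (k + 2)) / (k + 1)\<^sup>2"
    using k by (simp add: t_def divide_simps power2_eq_square) (simp add: algebra_simps)
  finally have "N\<^sup>2 * (k + 2) \<le> 0" using k by (simp add: field_simps)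
  then have "N = 0" using k by (auto simp: mult_le_0_iff)
  then show ?thesis by (simp add: N_def h_def)
qed

text \<open>The form of \<open>lam *\<^sub>R g x - f x\<close> is nonnegative and vanishes at
  \<open>p\<close>.\<close>

lemma extremal_imp_generalized_eigenvector:
  fixes f g :: "'a::real_inner \<Rightarrow> 'a"
  assumes f: "linear f" "\<And>x y. x \<bullet> f y = y \<bullet> f x"
    and g: "linear g" "\<And>x y. x \<bullet> g y = y \<bullet> g x"
    and le: "\<And>x. x \<bullet> f x \<le> lam * (x \<bullet> g x)" and p: "p \<bullet> f p = lam * (p \<bullet> g p)"
  shows "f p = lam *\<^sub>R g p"
proof -
  have "lam *\<^sub>R g p - f p = 0"
  proof (rule psd_form_zero_imp_zero[where g="\<lambda>x. lam *\<^sub>R g x - f x"])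
    show "linear (\<lambda>x. lam *\<^sub>R g x - f x)"
      by (intro linear_compose_sub linear_compose_scale_right f g)
    show "x \<bullet> (lam *\<^sub>R g y - f y) = y \<bullet> (lam *\<^sub>R g x - f x)" for x y
      by (simp only: inner_diff_right inner_scaleR_right f(2)[of x y] g(2)[of x y])
    show "0 \<le> x \<bullet> (lam *\<^sub>R g x - f x)" for x using le[of x] by (simp add: inner_simps)
    show "p \<bullet> (lam *\<^sub>R g p - f p) = 0" using p by (simp add: inner_simps)
  qed
  then show ?thesis by simp
qed

text \<open>The generalized Rayleigh quotient attains its maximum on the compact unit sphere; by
  homogeneity the bound holds everywhere, and the maximiser is then an eigenvector by
  extremality.\<close>

lemma generalized_eigenvector_max:
  fixes f g :: "'a::euclidean_space \<Rightarrow> 'a"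
  assumes f: "linear f" "\<And>x y. x \<bullet> f y = y \<bullet> f x" 
    and g: "linear g" "\<And>x y. x \<bullet> g y = y \<bullet> g x" "\<And>x. x \<noteq> 0 \<Longrightarrow> 0 < x \<bullet> g x"
  obtains lam p where "p \<noteq> 0" "f p = lam *\<^sub>R g p" "\<And>x. x \<bullet> f x \<le> lam * (x \<bullet> g x)"
proof -
  let ?q = "\<lambda>x. (x \<bullet> f x) / (x \<bullet> g x)"
  have "continuous_on (sphere 0 1) ?q"
    using g(3) by (intro continuous_intros linear_continuous_on linear_linear[THEN iffD2] f g)
      (metis norm_zero mem_sphere_0 less_irrefl zero_neq_one)
  moreover have "sphere (0::'a) 1 \<noteq> {}" by simp
  ultimately obtain p where p: "norm p = 1" and max: "\<And>x. norm x = 1 \<Longrightarrow> ?q x \<le> ?q p"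
    using continuous_attains_sup[of "sphere (0::'a) 1" ?q] by auto
  define lam where "lam = ?q p"
  have p0: "p \<noteq> 0" using p by auto
  have le: "x \<bullet> f x \<le> lam * (x \<bullet> g x)" for x
  proof (cases "x = 0")
    case False
    define y where "y = x /\<^sub>R norm x"
    have y: "norm y = 1" "x = norm x *\<^sub>R y" using False by (auto simp: y_def)
    then have "y \<noteq> 0" by auto
    then have "y \<bullet> f y \<le> lam * (y \<bullet> g y)" using max[OF y(1)] g(3)[of y] by (simp add: lam_def field_simps)
    then have "(norm x)\<^sup>2 * (y \<bullet> f y) \<le> (norm x)\<^sup>2 * (lam * (y \<bullet> g y))" by (rule mult_left_mono) simp
    moreover have "x \<bullet> f x = (norm x)\<^sup>2 * (y \<bullet> f y)" "x \<bullet> g x = (norm x)\<^sup>2 * (y \<bullet> g y)"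
      by (subst (1 2) y(2), simp add: linear_scale[OF f(1)] linear_scale[OF g(1)] power2_eq_square)+
    ultimately show ?thesis by (simp add: mult_ac)
  qed (simp add: linear_0[OF f(1)] linear_0[OF g(1)])
  have "p \<bullet> f p = lam * (p \<bullet> g p)" using g(3)[OF p0] by (simp add: lam_def)
  then show ?thesis
    using that p0 extremal_imp_generalized_eigenvector[OF f g(1,2) le] le by blast
qed

text \<open>Maximising for \<open>f\<close> and for \<open>- f\<close> gives the largest and the
  smallest quotient. If these agreed, every vector would be extremal and \<open>f\<close> would be a
  multiple of \<open>g\<close>.\<close>

lemma two_generalized_eigenvalues:
  fixes f g :: "'a::euclidean_space \<Rightarrow> 'a"
  assumes f: "linear f" "\<And>x y. x \<bullet> f y = y \<bullet> f x" 
    and g: "linear g" "\<And>x y. x \<bullet> g y = y \<bullet> g x" "\<And>x. x \<noteq> 0 \<Longrightarrow> 0 < x \<bullet> g x"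
    and neq: "\<And>c. \<exists>x. f x \<noteq> c *\<^sub>R g x"
  obtains lam mu p q where "lam \<noteq> mu" "p \<noteq> 0" "q \<noteq> 0" "f p = lam *\<^sub>R g p" "f q = mu *\<^sub>R g q"
proof -
  obtain lam p where p: "p \<noteq> 0" "f p = lam *\<^sub>R g p" "\<And>x. x \<bullet> f x \<le> lam * (x \<bullet> g x)"
    using generalized_eigenvector_max[OF f g] by blast
  obtain m q where q: "q \<noteq> 0" "- f q = m *\<^sub>R g q" "\<And>x. x \<bullet> (- f x) \<le> m * (x \<bullet> g x)"
    by (rule generalized_eigenvector_max[OF linear_compose_neg[OF f(1)] _ g]) (use f(2) in auto)
  have "lam \<noteq> - m"
  proof
    assume eq: "lam = - m"
    have "x \<bullet> f x = lam * (x \<bullet> g x)" for x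
      using p(3)[of x] q(3)[of x] eq by simp
    then have "f x = lam *\<^sub>R g x" for x
      using extremal_imp_generalized_eigenvector[OF f g(1,2)] by simp
    then show False using neq[of lam] by auto
  qed
  moreover have "f q = (- m) *\<^sub>R g q" using q(2) by (metis minus_equation_iff scaleR_minus_left)
  ultimately show ?thesis using that p q by blast
qed

section \<open>Volume of thin quadratic shells\<close>

text \<open>Squared radii between \<open>s\<close> and \<open>t\<close> describe a ring of area
  \<open>pi * (t - s)\<close> when \<open>s\<close> is nonnegative, whatever its position: the
  squared radius has constant density.\<close>

lemma emeasure_annulus_le:
  fixes a :: "real \<times> real"
  assumes "s \<le> t"
  shows "emeasure lborel {u. s \<le> (norm (u - a))\<^sup>2 \<and> (norm (u - a))\<^sup>2 \<le> t} \<le> ennreal (pi * (t - s))"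
proof (cases "0 \<le> t")
  case False
  then have "{u. s \<le> (norm (u - a))\<^sup>2 \<and> (norm (u - a))\<^sup>2 \<le> t} = {}"
    using order_trans[OF zero_le_power2] by blast
  then show ?thesis by (simp only: emeasure_empty zero_le)
next
  case True
  \<comment> \<open>The lower level may be negative; clipping it leaves the set unchanged and only
    shrinks the difference of levels.\<close>
  define s' where "s' = max s 0"
  have s': "0 \<le> s'" "s' \<le> t" "s \<le> s'" using assms True by (auto simp: s'_def)
  have eq: "{u. s \<le> (norm (u - a))\<^sup>2 \<and> (norm (u - a))\<^sup>2 \<le> t} = cball a (sqrt t) - ball a (sqrt s')"
  proof (safe, goal_cases)
    case (1 u)
    then show ?case by (auto simp: dist_norm norm_minus_commute intro: real_le_rsqrt)
  next
    case (2 u1 u2)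
    then have "sqrt s' \<le> norm ((u1,u2) - a)"
      using s' by (intro real_le_lsqrt) (auto simp: s'_def)
    with 2 show ?case by (simp add: dist_norm norm_minus_commute)
  next
    case (3 u1 u2)
    then have "sqrt s' \<le> norm ((u1,u2) - a)" by (simp add: dist_norm norm_minus_commute)
    then have "s' \<le> (norm ((u1,u2) - a))\<^sup>2" by (rule sqrt_le_D)
    then show ?case using s' by simp
  next
    case (4 u1 u2)
    then have "norm ((u1,u2) - a) \<le> sqrt t" by (simp add: dist_norm norm_minus_commute)
    then have "(norm ((u1,u2) - a))\<^sup>2 \<le> (sqrt t)\<^sup>2" by (intro power_mono) auto
    then show ?case using True by simp
  qed
  have "emeasure lborel (cball a (sqrt t) - ball a (sqrt s'))
      = emeasure lborel (cball a (sqrt t)) - emeasure lborel (ball a (sqrt s'))"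
    using s' by (intro emeasure_Diff)
      (auto simp: emeasure_ball intro: order_trans[OF less_imp_le real_sqrt_le_mono])
  also have "\<dots> = ennreal (pi * t - pi * s')"
    using s' True by (simp add: emeasure_ball emeasure_cball unit_ball_vol_2 ennreal_minus)
  also have "\<dots> \<le> ennreal (pi * (t - s))"
    using s' by (intro ennreal_leI) (simp add: algebra_simps)
  finally show ?thesis unfolding eq .
qed

text \<open>Subtracting \<open>mu\<close> times the first expression from the second eliminates
  \<open>v\<close> and puts \<open>u\<close> in a ring. For fixed \<open>u\<close> the first
  condition alone puts \<open>v\<close> in a ring of area at most \<open>2 * pi * e\<close>.
  Integrating over \<open>u\<close> multiplies the two areas.\<close>

lemma emeasure_two_circles_le:
  fixes a b :: "real \<times> real" and lam mu s r :: real
  assumes "lam \<noteq> mu" "0 \<le> e" "0 \<le> h"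
  shows "emeasure lborel {(u, v). \<bar>s + (norm (u - a))\<^sup>2 + (norm (v - b))\<^sup>2\<bar> \<le> e \<and>
      \<bar>r + lam * (norm (u - a))\<^sup>2 + mu * (norm (v - b))\<^sup>2\<bar> \<le> h}
    \<le> ennreal ((2 * pi)\<^sup>2 / \<bar>lam - mu\<bar> * e * (h + \<bar>mu\<bar> * e))"
    (is "emeasure lborel ?W \<le> _")
proof -
  \<comment> \<open>\<open>z\<close> is the value of the squared radius of \<open>u\<close> for
    which both expressions can vanish, and \<open>g\<close> is the tolerance left after the
    elimination.\<close>
  define g where "g = (h + \<bar>mu\<bar> * e) / \<bar>lam - mu\<bar>"
  define z where "z = - (r - mu * s) / (lam - mu)"
  have g: "0 \<le> g" using assms by (simp add: g_def)
  define U where "U = {u. z - g \<le> (norm (u - a))\<^sup>2 \<and> (norm (u - a))\<^sup>2 \<le> z + g}"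
  define V where "V = (\<lambda>u. {v. (- s - (norm (u - a))\<^sup>2) - e \<le> (norm (v - b))\<^sup>2 \<and> 
    (norm (v - b))\<^sup>2 \<le> (- s - (norm (u - a))\<^sup>2) + e})"
  have W: "closed ?W"
    unfolding case_prod_beta'
    by (intro closed_Collect_conj closed_Collect_le continuous_intros)
  have U_closed: "closed U"
    unfolding U_def by (intro closed_Collect_conj closed_Collect_le continuous_intros)
  have slice: "Pair u -` ?W \<subseteq> V u" "u \<notin> U \<Longrightarrow> Pair u -` ?W = {}" for u
  proof -
    show "Pair u -` ?W \<subseteq> V u" by (auto simp: V_def)
    have "u \<in> U" if "v \<in> Pair u -` ?W" for v
    proof -
      define X Y where "X = (norm (u - a))\<^sup>2" and "Y = (norm (v - b))\<^sup>2"
      have 1: "\<bar>s + X + Y\<bar> \<le> e" "\<bar>r + lam * X + mu * Y\<bar> \<le> h"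
        using that by (auto simp: X_def Y_def)
      have "\<bar>(lam - mu) * (X - z)\<bar> = \<bar>(r + lam * X + mu * Y) - mu * (s + X + Y)\<bar>"
        using assms(1) by (intro arg_cong[where f=abs]) (simp add: z_def field_simps)
      also have "\<dots> \<le> \<bar>r + lam * X + mu * Y\<bar> + \<bar>mu * (s + X + Y)\<bar>" by (rule abs_triangle_ineq4)
      also have "\<dots> \<le> h + \<bar>mu\<bar> * e"
        using 1 by (intro add_mono) (auto simp: abs_mult intro: mult_left_mono)
      finally have "\<bar>X - z\<bar> \<le> g"
        using assms(1) by (simp add: g_def abs_mult pos_le_divide_eq mult.commute)
      then show ?thesis by (auto simp: U_def X_def abs_le_iff)
    qed
    then show "Pair u -` ?W = {}" if "u \<notin> U" using that by blast
  qed
  have "emeasure lborel ?W = emeasure (lborel \<Otimes>\<^sub>M lborel) ?W" by (simp only: lborel_prod)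
  also have "\<dots> = (\<integral>\<^sup>+u. emeasure lborel (Pair u -` ?W) \<partial>lborel)"
    using W by (intro lborel.emeasure_pair_measure_alt) (simp only: lborel_prod sets_lborel borel_closed)
  also have "\<dots> \<le> (\<integral>\<^sup>+u. ennreal (2 * pi * e) * indicator U u \<partial>lborel)"
  proof (rule nn_integral_mono)
    fix u
    have V_closed: "closed (V u)"
      unfolding V_def by (intro closed_Collect_conj closed_Collect_le continuous_intros)
    have "emeasure lborel (V u) \<le> ennreal (2 * pi * e)"
      unfolding V_def using assms by (intro order_trans[OF emeasure_annulus_le]) (auto simp: algebra_simps)
    then have "emeasure lborel (Pair u -` ?W) \<le> ennreal (2 * pi * e)"
      using V_closed by (intro order_trans[OF emeasure_mono[OF slice(1)]]) auto
    moreover have "emeasure lborel (Pair u -` ?W) = 0" if "u \<notin> U"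
      unfolding slice(2)[OF that] by (rule emeasure_empty)
    ultimately show "emeasure lborel (Pair u -` ?W) \<le> ennreal (2 * pi * e) * indicator U u"
      by (cases "u \<in> U") (simp_all only: simp_thms indicator_simps mult_1_right zero_le)
  qed
  also have "\<dots> = ennreal (2 * pi * e) * emeasure lborel U"
    using U_closed by (intro nn_integral_cmult_indicator) auto
  also have "\<dots> \<le> ennreal (2 * pi * e) * ennreal (pi * (2 * g))"
    unfolding U_def using g by (intro mult_left_mono order_trans[OF emeasure_annulus_le]) auto
  also have "\<dots> = ennreal ((2 * pi)\<^sup>2 / \<bar>lam - mu\<bar> * e * (h + \<bar>mu\<bar> * e))"
    using assms g by (simp add: ennreal_mult'[symmetric] g_def power2_eq_square)
  finally show ?thesis .
qed

text \<open>By translation invariance the volume of \<open>V\<close> is the average over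
  \<open>w\<close> in the unit ball of the volume of \<open>V\<close> shifted by
  \<open>- L w\<close>. Exchanging the integrals leaves for each \<open>x\<close> a slice of measure
  at most \<open>m\<close>, and only points \<open>x\<close> with norm at most \<open>R + K\<close>
  contribute.\<close>

lemma emeasure_le_by_averaging:
  fixes V :: "'a::euclidean_space set" and L :: "'b::euclidean_space \<Rightarrow> 'a"
  assumes V: "V \<in> sets borel" "V \<subseteq> cball 0 R" and L: "linear L" "\<And>w. norm w \<le> 1 \<Longrightarrow> norm (L w) \<le> K"
    and m: "\<And>x. emeasure lborel {w. x + L w \<in> V} \<le> m"
  shows "emeasure lborel (cball (0::'b) 1) * emeasure lborel V \<le> m * emeasure lborel (cball (0::'a) (R + K))"
proof -
  have [measurable]: "L \<in> borel_measurable borel" "V \<in> sets borel"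
    using L(1) V(1) by (auto intro!: borel_measurable_continuous_onI linear_continuous_on
      simp: linear_linear)
  let ?Q = "cball (0::'b) 1"
  have "emeasure lborel ?Q * emeasure lborel V = (\<integral>\<^sup>+w. emeasure lborel V * indicator ?Q w \<partial>lborel)"
    by (subst nn_integral_cmult_indicator) (auto simp: mult.commute)
  also have "\<dots> = (\<integral>\<^sup>+w. (\<integral>\<^sup>+x. indicator V (x + L w) * indicator ?Q w \<partial>lborel) \<partial>lborel)"
  proof (rule nn_integral_cong)
    fix w
    have "emeasure lborel V = emeasure (distr lborel borel ((+) (L w))) V"
      by (simp add: lborel_distr_plus)
    also have "\<dots> = (\<integral>\<^sup>+x. indicator V (x + L w) \<partial>lborel)"
      by (subst nn_integral_indicator[symmetric], simp, subst nn_integral_distr) (auto simp: add.commute)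
    finally show "emeasure lborel V * indicator ?Q w = (\<integral>\<^sup>+x. indicator V (x + L w) * indicator ?Q w \<partial>lborel)"
      by (simp add: nn_integral_multc)
  qed
  also have "\<dots> = (\<integral>\<^sup>+x. (\<integral>\<^sup>+w. indicator V (x + L w) * indicator ?Q w \<partial>lborel) \<partial>lborel)"
    by (rule lborel_pair.Fubini')
      (measurable, simp add: measurable_split_conv)
  also have "\<dots> \<le> (\<integral>\<^sup>+x. m * indicator (cball (0::'a) (R + K)) x \<partial>lborel)"
  proof (rule nn_integral_mono)
    fix x :: 'a
    show "(\<integral>\<^sup>+w. indicator V (x + L w) * indicator ?Q w \<partial>lborel) \<le> m * indicator (cball 0 (R + K)) x"
    proof (cases "x \<in> cball 0 (R + K)")
      case True
      have "(\<integral>\<^sup>+w. indicator V (x + L w) * indicator ?Q w \<partial>lborel)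
          \<le> (\<integral>\<^sup>+w. indicator {w. x + L w \<in> V} w \<partial>lborel)"
        by (intro nn_integral_mono) (auto simp: indicator_def)
      also have "\<dots> \<le> m" using m by (subst nn_integral_indicator) auto
      finally show ?thesis using True by simp
    next
      case False
      have "indicator V (x + L w) * indicator ?Q w = (0::ennreal)" for w
      proof (cases "w \<in> ?Q \<and> x + L w \<in> V")
        case True
        then have "norm (x + L w) \<le> R" "norm (L w) \<le> K" using V L by auto
        then have "norm x \<le> R + K" using norm_triangle_ineq4[of "x + L w" "L w"] by simp
        with False show ?thesis by simp
      qed (auto simp: indicator_def)
      then show ?thesis by (simp only: nn_integral_const mult_zero_left zero_le)
    qed
  qed
  also have "\<dots> = m * emeasure lborel (cball (0::'a) (R + K))"
    by (rule nn_integral_cmult_indicator) auto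
  finally show ?thesis .
qed

text \<open>On each affine slice \<open>x + L w\<close> both forms reduce, after completing squares,
  to the situation of \<open>emeasure_two_circles_le\<close>, with a bound uniform in
  \<open>x\<close>; averaging turns it into a bound on the volume.\<close>

lemma emeasure_quadratic_shell_le:
  fixes f g :: "'a::euclidean_space \<Rightarrow> 'a"
  assumes f: "linear f" "\<And>x y. x \<bullet> f y = y \<bullet> f x"
    and g: "linear g" "\<And>x y. x \<bullet> g y = y \<bullet> g x"
    and eig: "f P1 = lam *\<^sub>R g P1" "f P2 = lam *\<^sub>R g P2" "f Q1 = mu *\<^sub>R g Q1" "f Q2 = mu *\<^sub>R g Q2"
    and lam_mu: "lam \<noteq> mu"
    and P: "P1 \<bullet> g P1 = 1" "P2 \<bullet> g P2 = 1" "P1 \<bullet> g P2 = 0"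
    and Q: "Q1 \<bullet> g Q1 = 1" "Q2 \<bullet> g Q2 = 1" "Q1 \<bullet> g Q2 = 0"
  obtains C where "0 \<le> C" "\<And>e h. 0 \<le> e \<Longrightarrow> 0 \<le> h \<Longrightarrow>
    emeasure lborel {y \<in> cball 0 R. \<bar>y \<bullet> g y - c\<bar> \<le> e \<and> \<bar>y \<bullet> f y - rho\<bar> \<le> h}
      \<le> ennreal (C * e * (h + \<bar>mu\<bar> * e))"
proof -
  \<comment> \<open>Symmetry of both forms makes eigenvectors for distinct eigenvalues orthogonal
    with respect to \<open>g\<close>.\<close>
  have "p \<bullet> g q = 0" if "f p = lam *\<^sub>R g p" "f q = mu *\<^sub>R g q" for p q
  proof -
    have "lam * (p \<bullet> g q) = mu * (p \<bullet> g q)"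
      using f(2)[of p q] g(2)[of p q] that by (metis inner_scaleR_right)
    then show ?thesis using lam_mu by simp
  qed
  then have PQ: "P1 \<bullet> g Q1 = 0" "P1 \<bullet> g Q2 = 0" "P2 \<bullet> g Q1 = 0" "P2 \<bullet> g Q2 = 0"
    using eig by auto
  have swap: "P2 \<bullet> g P1 = 0" "Q2 \<bullet> g Q1 = 0"
    "Q1 \<bullet> g P1 = 0" "Q2 \<bullet> g P1 = 0" "Q1 \<bullet> g P2 = 0" "Q2 \<bullet> g P2 = 0"
    using P(3) Q(3) PQ g(2) by metis+
  define L :: "(real \<times> real) \<times> (real \<times> real) \<Rightarrow> 'a" where
    "L w = fst (fst w) *\<^sub>R P1 + snd (fst w) *\<^sub>R P2 + fst (snd w) *\<^sub>R Q1 + snd (snd w) *\<^sub>R Q2" for w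
  have L: "linear L"
    by (rule linearI) (auto simp: L_def algebra_simps)
  then obtain K where K: "0 < K" "\<And>w. norm (L w) \<le> norm w * K"
    using bounded_linear.pos_bounded linear_conv_bounded_linear by metis
  have L_le: "norm (L w) \<le> K" if "norm w \<le> 1" for w
    using order_trans[OF K(2)[of w] mult_right_mono[OF that]] K(1) by simp
  \<comment> \<open>\<open>k\<close> is the volume of the parameter ball, divided out after
    averaging. Below, \<open>R'\<close> clips the radius at zero so that the ball volume formula
    applies.\<close>
  define k where "k = unit_ball_vol (real DIM((real \<times> real) \<times> (real \<times> real)))"
  define R' where "R' = max 0 (R + K)"
  define b where "b = unit_ball_vol (real DIM('a)) * R' ^ DIM('a)"
  define C where "C = (2 * pi)\<^sup>2 / \<bar>lam - mu\<bar> * b / k"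
  have k: "0 < k" by (simp add: k_def)
  have b: "0 \<le> b" by (simp add: b_def R'_def)
  show thesis
  proof
    show "0 \<le> C" using k b by (simp add: C_def)
    fix e h :: real assume eh: "0 \<le> e" "0 \<le> h"
    let ?V = "{y \<in> cball 0 R. \<bar>y \<bullet> g y - c\<bar> \<le> e \<and> \<bar>y \<bullet> f y - rho\<bar> \<le> h}"
    define m where "m = (2 * pi)\<^sup>2 / \<bar>lam - mu\<bar> * e * (h + \<bar>mu\<bar> * e)"
    have m0: "0 \<le> m" using eh by (simp add: m_def)
    have "?V = cball 0 R \<inter> {y. \<bar>y \<bullet> g y - c\<bar> \<le> e \<and> \<bar>y \<bullet> f y - rho\<bar> \<le> h}" by auto
    moreover have "closed \<dots>"
      by (intro closed_Int closed_cball closed_Collect_conj closed_Collect_le continuous_intros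
          linear_continuous_on linear_linear[THEN iffD2] f g)
    ultimately have V: "?V \<in> sets borel" by simp
    have slice: "emeasure lborel {w. x + L w \<in> ?V} \<le> ennreal m" for x
    proof -
      \<comment> \<open>The centres come from completing the squares; \<open>s\<close> and
        \<open>r\<close> collect the remaining terms, which do not depend on
        \<open>w\<close>.\<close>
      define a where "a = (- (P1 \<bullet> g x), - (P2 \<bullet> g x))"
      define a' where "a' = (- (Q1 \<bullet> g x), - (Q2 \<bullet> g x))"
      define s where "s = x \<bullet> g x - c - (norm a)\<^sup>2 - (norm a')\<^sup>2"
      define r where "r = x \<bullet> f x - rho - lam * (norm a)\<^sup>2 - mu * (norm a')\<^sup>2"
      let ?W = "{(u, v). \<bar>s + (norm (u - a))\<^sup>2 + (norm (v - a'))\<^sup>2\<bar> \<le> e \<and>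
        \<bar>r + lam * (norm (u - a))\<^sup>2 + mu * (norm (v - a'))\<^sup>2\<bar> \<le> h}"
      have sq: "(x + L (u, v)) \<bullet> g (x + L (u, v)) - c = s + (norm (u - a))\<^sup>2 + (norm (v - a'))\<^sup>2"
        "(x + L (u, v)) \<bullet> f (x + L (u, v)) - rho = r + lam * (norm (u - a))\<^sup>2 + mu * (norm (v - a'))\<^sup>2"
        for u v
      proof -
        have norm_sq: "(norm (y, z))\<^sup>2 = y * y + z * z" for y z :: real
          by (simp add: norm_Pair flip: power2_eq_square)
        obtain u1 u2 v1 v2 where uv: "u = (u1, u2)" "v = (v1, v2)" by (metis surj_pair)
        have gx: "x \<bullet> g P1 = P1 \<bullet> g x" "x \<bullet> g P2 = P2 \<bullet> g x" "x \<bullet> g Q1 = Q1 \<bullet> g x" "x \<bullet> g Q2 = Q2 \<bullet> g x"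
          by (rule g(2))+
        have fx: "P1 \<bullet> f x = lam * (P1 \<bullet> g x)" "P2 \<bullet> f x = lam * (P2 \<bullet> g x)"
          "Q1 \<bullet> f x = mu * (Q1 \<bullet> g x)" "Q2 \<bullet> f x = mu * (Q2 \<bullet> g x)"
          using f(2)[of _ x] eig gx by simp_all
        show "(x + L (u, v)) \<bullet> g (x + L (u, v)) - c = s + (norm (u - a))\<^sup>2 + (norm (v - a'))\<^sup>2"
          unfolding uv s_def a_def a'_def L_def
          by (simp add: linear_add[OF g(1)] linear_scale[OF g(1)] inner_add_left inner_add_right
              gx P Q PQ swap norm_sq algebra_simps)
        show "(x + L (u, v)) \<bullet> f (x + L (u, v)) - rho
            = r + lam * (norm (u - a))\<^sup>2 + mu * (norm (v - a'))\<^sup>2"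
          unfolding uv r_def a_def a'_def L_def
          by (simp add: linear_add[OF f(1)] linear_scale[OF f(1)] inner_add_left inner_add_right
              eig fx gx P Q PQ swap norm_sq algebra_simps)
      qed
      have "{w. x + L w \<in> ?V} \<subseteq> ?W" by (auto simp: sq)
      moreover have "closed ?W"
        unfolding case_prod_beta'
        by (intro closed_Collect_conj closed_Collect_le continuous_intros)
      ultimately have "emeasure lborel {w. x + L w \<in> ?V} \<le> emeasure lborel ?W"
        by (intro emeasure_mono) (simp_all only: sets_lborel borel_closed)
      also have "\<dots> \<le> ennreal m"
        unfolding m_def by (rule emeasure_two_circles_le[OF lam_mu eh])
      finally show ?thesis .
    qed
    have "ennreal k * emeasure lborel ?V
        = emeasure lborel (cball (0::(real \<times> real) \<times> (real \<times> real)) 1) * emeasure lborel ?V"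
      by (simp add: emeasure_cball k_def)
    also have "\<dots> \<le> ennreal m * emeasure lborel (cball (0::'a) (R + K))"
      by (rule emeasure_le_by_averaging[OF V _ L L_le slice]) auto
    also have "\<dots> \<le> ennreal m * ennreal b"
    proof (rule mult_left_mono)
      have "emeasure lborel (cball (0::'a) (R + K)) \<le> emeasure lborel (cball (0::'a) R')"
        by (intro emeasure_mono) (auto simp: R'_def)
      also have "\<dots> = ennreal b"
        unfolding b_def by (rule emeasure_cball) (simp add: R'_def)
      finally show "emeasure lborel (cball (0::'a) (R + K)) \<le> ennreal b" .
    qed simp
    finally have le: "ennreal k * emeasure lborel ?V \<le> ennreal (m * b)"
      using m0 by (simp add: ennreal_mult')
    have "emeasure lborel ?V = ennreal (1 / k) * (ennreal k * emeasure lborel ?V)"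
      using k by (simp add: mult.assoc[symmetric] ennreal_mult'[symmetric])
    also have "\<dots> \<le> ennreal (1 / k) * ennreal (m * b)" by (intro mult_left_mono le) simp
    also have "\<dots> = ennreal (C * e * (h + \<bar>mu\<bar> * e))"
      using k by (simp add: ennreal_mult'[symmetric] C_def m_def mult_ac)
    finally show "emeasure lborel ?V \<le> ennreal (C * e * (h + \<bar>mu\<bar> * e))" .
  qed
qed

section \<open>From shell volumes to the Hausdorff measure of a slab in a level set\<close>

text \<open>By symmetry the difference of values is \<open>(y - x) \<bullet> f (y + x)\<close>, so a
  quadratic form is Lipschitz on bounded sets. This controls both forms on a neighbourhood of the
  slab.\<close>

lemma quadratic_form_diff_le:
  fixes f :: "'a::euclidean_space \<Rightarrow> 'a"
  assumes f: "linear f" "\<And>x y. x \<bullet> f y = y \<bullet> f x"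
  obtains K where "0 < K" "\<And>x y. norm x \<le> R \<Longrightarrow> norm y \<le> R \<Longrightarrow> \<bar>y \<bullet> f y - x \<bullet> f x\<bar> \<le> K * dist x y"
proof -
  obtain B where B: "0 < B" "\<And>x. norm (f x) \<le> norm x * B"
    using bounded_linear.pos_bounded f(1) linear_conv_bounded_linear by metis
  show thesis
  proof
    show "0 < B * (2 * \<bar>R\<bar> + 1)" using B by (intro mult_pos_pos) auto
    fix x y :: 'a assume xy: "norm x \<le> R" "norm y \<le> R"
    have "y \<bullet> f y - x \<bullet> f x = (y - x) \<bullet> f (y + x)"
      using f(2)[of x y] by (simp add: linear_add[OF f(1)] inner_simps)
    also have "\<bar>\<dots>\<bar> \<le> norm (y - x) * norm (f (y + x))" by (rule Cauchy_Schwarz_ineq2)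
    also have "\<dots> \<le> norm (y - x) * (norm (y + x) * B)" by (intro mult_left_mono B) auto
    also have "\<dots> \<le> norm (y - x) * ((2 * \<bar>R\<bar> + 1) * B)"
      using xy B norm_triangle_ineq[of y x] by (intro mult_left_mono mult_right_mono) auto
    finally show "\<bar>y \<bullet> f y - x \<bullet> f x\<bar> \<le> B * (2 * \<bar>R\<bar> + 1) * dist x y"
      by (simp add: dist_norm norm_minus_commute mult_ac)
  qed
qed

text \<open>Maximising the quotient of the Euclidean form by the form of \<open>g\<close> bounds the
  squared norm by \<open>lam * c\<close> on the level set.\<close>

lemma pos_def_form_level_bounded:
  fixes g :: "'a::euclidean_space \<Rightarrow> 'a"
  assumes g: "linear g" "\<And>x y. x \<bullet> g y = y \<bullet> g x" "\<And>x. x \<noteq> 0 \<Longrightarrow> 0 < x \<bullet> g x"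
  obtains R where "0 < R" "\<And>x. x \<bullet> g x = c \<Longrightarrow> norm x \<le> R"
proof -
  obtain lam where lam: "\<And>x. x \<bullet> x \<le> lam * (x \<bullet> g x)"
    using generalized_eigenvector_max[of "\<lambda>x. x", OF _ _ g] by (auto simp: linear_ident inner_commute)
  show thesis
  proof
    show "0 < \<bar>lam * c\<bar> + 1" by simp
    fix x assume "x \<bullet> g x = c"
    then have "(norm x)\<^sup>2 \<le> \<bar>lam * c\<bar>" using lam[of x] by (simp add: power2_norm_eq_inner)
    also have "\<dots> \<le> (\<bar>lam * c\<bar> + 1)\<^sup>2" 
      unfolding power2_sum using zero_le_power2[of "\<bar>lam * c\<bar>"] abs_ge_zero[of "lam * c"] by simp
    finally show "norm x \<le> \<bar>lam * c\<bar> + 1" by (rule power2_le_imp_le) simp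
  qed
qed

text \<open>The \<open>r / 2\<close>-neighbourhood of the slab lies in a shell of tolerances
  \<open>Kg * r\<close> and \<open>\<beta> + Kf * r\<close>, whose volume is O(\<beta> r) for
  \<open>r \<le> \<beta>\<close>. The packing bound divides by \<open>r\<close> and leaves
  O(\<beta>).\<close>

lemma hausdorff_outer_level_slab_le:
  fixes f g :: "'a::euclidean_space \<Rightarrow> 'a"
  assumes f: "linear f" "\<And>x y. x \<bullet> f y = y \<bullet> f x"
    and g: "linear g" "\<And>x y. x \<bullet> g y = y \<bullet> g x" "\<And>x. x \<noteq> 0 \<Longrightarrow> 0 < x \<bullet> g x"
    and eig: "f P1 = lam *\<^sub>R g P1" "f P2 = lam *\<^sub>R g P2" "f Q1 = mu *\<^sub>R g Q1" "f Q2 = mu *\<^sub>R g Q2"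
    and lam_mu: "lam \<noteq> mu"
    and P: "P1 \<bullet> g P1 = 1" "P2 \<bullet> g P2 = 1" "P1 \<bullet> g P2 = 0"
    and Q: "Q1 \<bullet> g Q1 = 1" "Q2 \<bullet> g Q2 = 1" "Q1 \<bullet> g Q2 = 0"
  obtains C where "0 < C" "\<And>\<beta>. 0 < \<beta> \<Longrightarrow> \<beta> < 1 \<Longrightarrow>
    hausdorff_outer (DIM('a) - 1) {x. x \<bullet> g x = c \<and> \<bar>x \<bullet> f x - rho\<bar> \<le> \<beta>} \<le> ennreal (C * \<beta>)"
proof -
  obtain R where R: "0 < R" "\<And>x. x \<bullet> g x = c \<Longrightarrow> norm x \<le> R"
    using pos_def_form_level_bounded[OF g] by blast
  obtain C where C: "0 \<le> C" "\<And>e h. 0 \<le> e \<Longrightarrow> 0 \<le> h \<Longrightarrow>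
    emeasure lborel {y \<in> cball 0 (R + 1). \<bar>y \<bullet> g y - c\<bar> \<le> e \<and> \<bar>y \<bullet> f y - rho\<bar> \<le> h}
      \<le> ennreal (C * e * (h + \<bar>mu\<bar> * e))"
    using emeasure_quadratic_shell_le[OF f g(1,2) eig lam_mu P Q] by blast
  obtain Kf where Kf: "0 < Kf"
    "\<And>x y. norm x \<le> R + 1 \<Longrightarrow> norm y \<le> R + 1 \<Longrightarrow> \<bar>y \<bullet> f y - x \<bullet> f x\<bar> \<le> Kf * dist x y"
    using quadratic_form_diff_le[OF f] by blast
  obtain Kg where Kg: "0 < Kg"
    "\<And>x y. norm x \<le> R + 1 \<Longrightarrow> norm y \<le> R + 1 \<Longrightarrow> \<bar>y \<bullet> g y - x \<bullet> g x\<bar> \<le> Kg * dist x y"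
    using quadratic_form_diff_le[OF g(1,2)] by blast
  let ?n = "DIM('a)"
  define D where "D = C * Kg * (1 + Kf + \<bar>mu\<bar> * Kg)"
  define E where "E = unit_ball_vol (real (?n - 1)) / unit_ball_vol (real ?n) * 2 ^ ?n * D"
  have D: "0 \<le> D" using C Kf Kg by (simp add: D_def)
  have E: "0 \<le> E" using D by (simp add: E_def)
  show thesis
  proof
    \<comment> \<open>\<open>E\<close> is only known to be nonnegative, while the constant must be
      positive.\<close>
    show "0 < E + 1" using E by simp
    fix \<beta> :: real assume \<beta>: "0 < \<beta>" "\<beta> < 1"
    let ?S = "{x. x \<bullet> g x = c \<and> \<bar>x \<bullet> f x - rho\<bar> \<le> \<beta>}"
    have "hausdorff_outer (?n - 1) ?S \<le> ennreal (E * \<beta>)"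
    proof (rule hausdorff_outer_le_if_small_pre[OF \<beta>(1)])
      fix r' :: real assume "0 < r'" "r' \<le> \<beta>"
      then obtain r where r: "r' = 2 * r" "0 < r" "r \<le> \<beta>" by (auto intro: that[of "r' / 2"])
      let ?T = "{y \<in> cball 0 (R + 1). \<bar>y \<bullet> g y - c\<bar> \<le> Kg * r \<and> \<bar>y \<bullet> f y - rho\<bar> \<le> \<beta> + Kf * r}"
      have "?T = cball 0 (R + 1) \<inter> {y. \<bar>y \<bullet> g y - c\<bar> \<le> Kg * r \<and> \<bar>y \<bullet> f y - rho\<bar> \<le> \<beta> + Kf * r}"
        by auto
      moreover have "closed \<dots>"
        by (intro closed_Int closed_cball closed_Collect_conj closed_Collect_le continuous_intros
            linear_continuous_on linear_linear[THEN iffD2] f g)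
      ultimately have T: "?T \<in> sets lborel" by simp
      have "emeasure lborel ?T \<le> ennreal (C * (Kg * r) * (\<beta> + Kf * r + \<bar>mu\<bar> * (Kg * r)))"
        using Kf Kg r \<beta> by (intro C(2)) auto
      \<comment> \<open>Since \<open>r \<le> \<beta>\<close>, the errors inside the second tolerance
        become multiples of \<open>\<beta>\<close>; the outer factor \<open>r\<close> is kept to
        cancel in the packing bound.\<close>
      also have "\<dots> \<le> ennreal (C * (Kg * r) * (\<beta> + Kf * \<beta> + \<bar>mu\<bar> * (Kg * \<beta>)))"
        using Kf Kg r \<beta> C by (intro ennreal_leI mult_left_mono add_mono) auto
      also have "\<dots> = ennreal (D * \<beta> * r)" by (simp add: D_def algebra_simps)
      finally have vol: "emeasure lborel ?T \<le> ennreal (D * \<beta> * r)" .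
      have nbhd: "ball x (r / 2) \<subseteq> ?T" if x: "x \<in> ?S" for x
      proof
        fix y assume "y \<in> ball x (r / 2)"
        then have d: "dist x y \<le> r" "dist x y \<le> 1" using r \<beta> by auto
        have nx: "norm x \<le> R" using x R by auto
        moreover have "norm y \<le> norm x + dist x y"
          by (metis dist_norm norm_minus_commute norm_triangle_sub)
        ultimately have n: "norm x \<le> R + 1" "norm y \<le> R + 1" using d by auto
        have "Kg * dist x y \<le> Kg * r" "Kf * dist x y \<le> Kf * r" using d Kf Kg by auto
        then have "\<bar>y \<bullet> g y - x \<bullet> g x\<bar> \<le> Kg * r" "\<bar>y \<bullet> f y - x \<bullet> f x\<bar> \<le> Kf * r"
          using Kf(2)[OF n] Kg(2)[OF n] by auto
        then show "y \<in> ?T" using x n by auto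
      qed
      show "hausdorff_pre (?n - 1) r' ?S \<le> ennreal (E * \<beta>)"
        unfolding r(1)
        by (rule order_trans[OF hausdorff_pre_le_volume[OF r(2) T vol _ nbhd]])
          (use D r \<beta> in \<open>auto simp: E_def mult_ac\<close>)
    qed
    also have "\<dots> \<le> ennreal ((E + 1) * \<beta>)" using \<beta> by (intro ennreal_leI mult_right_mono) auto
    finally show "hausdorff_outer (?n - 1) ?S \<le> ennreal ((E + 1) * \<beta>)" .
  qed
qed

section \<open>Block matrices\<close>

lemma symmetric_matrix_inner_swap:
  assumes "symmetric_matrix M"
  shows "x \<bullet> (M *v y) = y \<bullet> (M *v x)"
  using assms unfolding symmetric_matrix_def
  by (metis dot_lmul_matrix inner_commute transpose_matrix_vector)

text \<open>A block matrix is the tensor product of \<open>a\<close> with the identity: it mixes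
  blocks and carries the coordinate index \<open>k\<close> along.\<close>

lemma block_matrix_vector_mult:
  fixes M :: "real ^ ('l::finite \<times> 'd::finite) ^ ('l \<times> 'd)"
  assumes "is_block_matrix M"
  obtains a :: "'l \<Rightarrow> 'l \<Rightarrow> real" where "\<And>x i k. (M *v x) $ (i, k) = (\<Sum>j\<in>UNIV. a i j * x $ (j, k))"
proof -
  obtain a where a: "\<And>i j k m. M $ (i, k) $ (j, m) = a i j * (mat 1 :: real ^ 'd ^ 'd) $ k $ m"
    using assms unfolding is_block_matrix_def by blast
  have "(M *v x) $ (i, k) = (\<Sum>j\<in>UNIV. a i j * x $ (j, k))" for x i k
  proof -
    have "(M *v x) $ (i, k) = (\<Sum>jm\<in>UNIV \<times> UNIV. M $ (i, k) $ jm * x $ jm)"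
      by (simp add: matrix_vector_mult_def)
    also have "\<dots> = (\<Sum>j\<in>UNIV. \<Sum>m\<in>UNIV. M $ (i, k) $ (j, m) * x $ (j, m))"
      by (simp add: sum.cartesian_product case_prod_beta)
    also have "\<dots> = (\<Sum>j\<in>UNIV. a i j * x $ (j, k))"
      by (simp add: a mat_def if_distrib if_distribR cong: if_cong)
    finally show ?thesis .
  qed
  then show ?thesis using that by blast
qed

text \<open>
  Block matrices commute with these maps, so a generalized eigenvector yields one for each index
  \<open>m\<close>.
\<close>
definition shift_component :: "'d \<Rightarrow> 'd \<Rightarrow> real ^ ('l::finite \<times> 'd::finite) \<Rightarrow> real ^ ('l \<times> 'd)" where
  "shift_component k m x = (\<chi> ij. if snd ij = m then x $ (fst ij, k) else 0)"

lemma shift_component_scaleR: "shift_component k m (c *\<^sub>R x) = c *\<^sub>R shift_component k m x"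
  by (simp add: shift_component_def vec_eq_iff)

lemma block_matrix_shift_component:
  assumes "is_block_matrix M"
  shows "M *v shift_component k m x = shift_component k m (M *v x)"
proof -
  obtain a where "\<And>x i k. (M *v x) $ (i, k) = (\<Sum>j\<in>UNIV. a i j * x $ (j, k))"
    using block_matrix_vector_mult[OF assms] by blast
  then show ?thesis by (simp add: vec_eq_iff shift_component_def)
qed

lemma inner_shift_component:
  fixes x y :: "real ^ ('l::finite \<times> 'd::finite)"
  shows "shift_component k m x \<bullet> shift_component k m' y
    = (if m = m' then \<Sum>i\<in>UNIV. x $ (i, k) * y $ (i, k) else 0)"
proof -
  have "shift_component k m x \<bullet> shift_component k m' y
      = (\<Sum>ij\<in>UNIV \<times> UNIV. shift_component k m x $ ij * shift_component k m' y $ ij)"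
    by (simp add: inner_vec_def)
  also have "\<dots> = (\<Sum>i\<in>UNIV. \<Sum>j\<in>UNIV. shift_component k m x $ (i, j) * shift_component k m' y $ (i, j))"
    by (simp add: sum.cartesian_product case_prod_beta)
  also have "\<dots> = (\<Sum>i\<in>UNIV. \<Sum>j\<in>UNIV.
      if j = m then if m = m' then x $ (i, k) * y $ (i, k) else 0 else 0)"
    by (intro sum.cong refl) (simp add: shift_component_def)
  also have "\<dots> = (if m = m' then \<Sum>i\<in>UNIV. x $ (i, k) * y $ (i, k) else 0)"
    by simp
  finally show ?thesis .
qed

text \<open>Copying the \<open>k\<close>-th coordinates of \<open>p\<close> into two different
  positions \<open>m1\<close> and \<open>m2\<close> gives two eigenvectors with disjoint supports.
  Applying \<open>B\<close> preserves these supports, so the copies are orthogonal for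
  \<open>B\<close>, and both have the same value \<open>N\<close>.\<close>

lemma block_eigenvector_pair:
  fixes A B :: "real ^ ('l::finite \<times> 'd::finite) ^ ('l \<times> 'd)"
  assumes d: "CARD('d) \<ge> 2" and A: "is_block_matrix A" and B: "is_block_matrix B" "positive_definite B"
    and p: "p \<noteq> 0" "A *v p = lam *\<^sub>R (B *v p)"
  obtains P1 P2 where "A *v P1 = lam *\<^sub>R (B *v P1)" "A *v P2 = lam *\<^sub>R (B *v P2)"
    "P1 \<bullet> (B *v P1) = 1" "P2 \<bullet> (B *v P2) = 1" "P1 \<bullet> (B *v P2) = 0"
proof -
  \<comment> \<open>Choosing \<open>k\<close> with a nonzero entry keeps the copies nonzero, so that
    \<open>N\<close> is positive and they can be normalised.\<close>
  obtain i k where ik: "p $ (i, k) \<noteq> 0" using p(1) by (auto simp: vec_eq_iff)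
  obtain m1 m2 :: 'd where m: "m1 \<noteq> m2"
    using d card_le_Suc0_iff_eq[of "UNIV :: 'd set"] by auto
  define N where "N = (\<Sum>i\<in>UNIV. p $ (i, k) * (B *v p) $ (i, k))"
  have in_B: "shift_component k m p \<bullet> (B *v shift_component k m' p) = (if m = m' then N else 0)" for m m'
    by (simp add: block_matrix_shift_component[OF B(1)] inner_shift_component N_def)
  have "shift_component k m1 p $ (i, m1) \<noteq> 0" using ik by (simp add: shift_component_def)
  then have "shift_component k m1 p \<noteq> 0" by (metis zero_index)
  then have N: "0 < N" using B(2) in_B[of m1 m1] unfolding positive_definite_def by metis
  define P where "P m = (1 / sqrt N) *\<^sub>R shift_component k m p" for m
  have "A *v P m = lam *\<^sub>R (B *v P m)" for m
    by (simp add: P_def matrix_vector_mult_scaleR block_matrix_shift_component A B p(2) shift_component_scaleR)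
  moreover have "P m \<bullet> (B *v P m') = (if m = m' then 1 else 0)" for m m'
    using N by (simp add: P_def matrix_vector_mult_scaleR in_B)
  ultimately show thesis using that[of "P m1" "P m2"] m by simp
qed

section \<open>The annulus on the ellipsoid\<close>

theorem lemma7p15:
  fixes A B :: "real ^ ('l::finite \<times> 'd::finite) ^ ('l \<times> 'd)" and c \<rho> :: real
  assumes "CARD('l) \<ge> 1" and "CARD('d) \<ge> 2"
    and "c > 0"
    and "is_block_matrix B" and "symmetric_matrix B" and "positive_definite B"
    and "is_block_matrix A" and "symmetric_matrix A" and "A \<noteq> 0"
    and "\<And>\<alpha> :: real. A \<noteq> \<alpha> *\<^sub>R B"
  shows "\<exists>C :: real. C > 0 \<and> (\<forall>\<beta> :: real. 0 < \<beta> \<and> \<beta> < 1 \<and> \<beta> < \<rho> \<longrightarrow>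
    (\<integral>\<^sup>+ x. indicator (quadratic_annulus A \<beta> \<rho>) x \<partial>surface_measure (ellipsoid B c))
      \<le> ennreal (C * \<beta>))"
proof -
  let ?H = "hausdorff_measure (DIM(real ^ ('l \<times> 'd)) - 1) :: (real ^ ('l \<times> 'd)) measure"
  note f = matrix_vector_mul_linear[of A] symmetric_matrix_inner_swap[OF assms(8)]
  note g = matrix_vector_mul_linear[of B] symmetric_matrix_inner_swap[OF assms(5)]
    assms(6)[unfolded positive_definite_def, rule_format]
  have "\<exists>x. A *v x \<noteq> c *\<^sub>R (B *v x)" for c
    using assms(10)[of c] by (auto simp: matrix_eq scaleR_matrix_vector_assoc)
  then obtain lam mu p q where eig: "lam \<noteq> mu" "p \<noteq> 0" "q \<noteq> 0"
    "A *v p = lam *\<^sub>R (B *v p)" "A *v q = mu *\<^sub>R (B *v q)"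
    using two_generalized_eigenvalues[OF f g] by blast
  obtain P1 P2 where P: "A *v P1 = lam *\<^sub>R (B *v P1)" "A *v P2 = lam *\<^sub>R (B *v P2)"
    "P1 \<bullet> (B *v P1) = 1" "P2 \<bullet> (B *v P2) = 1" "P1 \<bullet> (B *v P2) = 0"
    using block_eigenvector_pair[OF assms(2,7,4,6) eig(2,4)] by blast
  obtain Q1 Q2 where Q: "A *v Q1 = mu *\<^sub>R (B *v Q1)" "A *v Q2 = mu *\<^sub>R (B *v Q2)"
    "Q1 \<bullet> (B *v Q1) = 1" "Q2 \<bullet> (B *v Q2) = 1" "Q1 \<bullet> (B *v Q2) = 0"
    using block_eigenvector_pair[OF assms(2,7,4,6) eig(3,5)] by blast
  obtain C where C: "0 < C" "\<And>\<beta>. 0 < \<beta> \<Longrightarrow> \<beta> < 1 \<Longrightarrow>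
      hausdorff_outer (DIM(real ^ ('l \<times> 'd)) - 1)
        {x. x \<bullet> (B *v x) = c \<and> \<bar>x \<bullet> (A *v x) - \<rho>\<bar> \<le> \<beta>} \<le> ennreal (C * \<beta>)"
    using hausdorff_outer_level_slab_le[OF f g P(1,2) Q(1,2) eig(1) P(3-5) Q(3-5)] by blast
  have "(\<integral>\<^sup>+ x. indicator (quadratic_annulus A \<beta> \<rho>) x \<partial>surface_measure (ellipsoid B c))
      \<le> ennreal (C * \<beta>)" if \<beta>: "0 < \<beta>" "\<beta> < 1" for \<beta>
  proof -
    have "closed (ellipsoid B c)" "closed (quadratic_annulus A \<beta> \<rho>)"
      unfolding ellipsoid_def quadratic_annulus_def
      by (intro closed_Collect_conj closed_Collect_le closed_Collect_eq continuous_intros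
          linear_continuous_on linear_linear[THEN iffD2] f g)+
    then have sets: "ellipsoid B c \<in> sets borel" "quadratic_annulus A \<beta> \<rho> \<in> sets borel" by auto
    \<comment> \<open>Both sets are Borel, so the surface integral is the Hausdorff outer measure of
      their intersection, which is the slab bounded above.\<close>
    have "(\<integral>\<^sup>+ x. indicator (quadratic_annulus A \<beta> \<rho>) x \<partial>surface_measure (ellipsoid B c))
        = (\<integral>\<^sup>+ x. indicator (quadratic_annulus A \<beta> \<rho>) x * indicator (ellipsoid B c) x \<partial>?H)"
      unfolding surface_measure_def using sets by (intro nn_integral_restrict_space) simp
    also have "\<dots> = (\<integral>\<^sup>+ x. indicator (quadratic_annulus A \<beta> \<rho> \<inter> ellipsoid B c) x \<partial>?H)"
      by (simp only: indicator_inter_arith)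
    also have "\<dots> = hausdorff_outer (DIM(real ^ ('l \<times> 'd)) - 1) (quadratic_annulus A \<beta> \<rho> \<inter> ellipsoid B c)"
      using sets by (subst nn_integral_indicator) (auto intro: emeasure_hausdorff_measure)
    also have "quadratic_annulus A \<beta> \<rho> \<inter> ellipsoid B c
        = {x. x \<bullet> (B *v x) = c \<and> \<bar>x \<bullet> (A *v x) - \<rho>\<bar> \<le> \<beta>}"
      by (auto simp: quadratic_annulus_def ellipsoid_def)
    also have "hausdorff_outer (DIM(real ^ ('l \<times> 'd)) - 1) \<dots> \<le> ennreal (C * \<beta>)"
      using \<beta> by (rule C(2))
    finally show ?thesis .
  qed
  then show ?thesis using C(1) by blast
qed

end
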